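(* Let $\mathbb{F}$ be an algebraically closed field with $\mathrm{Char}(\mathbb{F})=2$. Then any nontrivial $2$-dimensional Jordan algebra over $\mathbb{F}$ is isomorphic to one and only one of the following algebras, given by their matrices of structure constants (different values of a parameter count as different algebras in the list): $$J_{1,2}=\begin{pmatrix}0&1&1&0\\0&0&1&1\end{pmatrix},\qquad J_{2,2}=\begin{pmatrix}1&1&1&0\\0&0&0&1\end{pmatrix},$$ $$J_{3,2}(\alpha_1)=\begin{pmatrix}\alpha_1&0&0&0\\0&1&\alpha_1+1&0\end{pmatrix},\ \text{where }\alpha_1\in\mathbb{F},$$ $$J_{4,2}(\alpha_1)=\begin{pmatrix}\alpha_1&0&0&0\\0&\sqrt{\alpha_1+\alpha_1^2}&\alpha_1+1&0\end{pmatrix},\ \text{where }\alpha_1\in\mathbb{F},\ \alpha_1^2+\alpha_1+1\neq0,$$ $$J_{5,2}(\alpha_1)=\begin{pmatrix}\alpha_1&0&0&0\\1&1&\alpha_1+1&0\end{pmatrix},\ \text{where }\alpha_1\in\mathbb{F},\ \alpha_1^2+\alpha_1+1=0,$$ $$J_{6,2}=\begin{pmatrix}1&0&0&0\\0&0&1&0\end{pmatrix},\qquad J_{7,2}=\begin{pmatrix}0&1&1&0\\0&0&0&1\end{pmatrix},\qquad J_{8,2}=\begin{pmatrix}0&0&0&0\\1&0&0&0\end{pmatrix}.$$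
   Context: An algebra over a field $\mathbb{F}$ is an $\mathbb{F}$-vector space $\mathbb{A}$ with a bilinear multiplication $\cdot$ (not assumed associative, commutative or unital); it is nontrivial if the multiplication is not identically zero. Two algebras are isomorphic if there is an invertible linear map between them preserving the multiplication. An algebra $\mathbb{A}$ is a Jordan algebra if $(\mathbf{u}\cdot\mathbf{v})\cdot\mathbf{u}^2=\mathbf{u}\cdot(\mathbf{v}\cdot\mathbf{u}^2)$ for all $\mathbf{u},\mathbf{v}\in\mathbb{A}$, where $\mathbf{u}^2=\mathbf{u}\cdot\mathbf{u}$; commutativity is NOT assumed. The matrix of structure constants $A=\begin{pmatrix}\alpha_1&\alpha_2&\alpha_3&\alpha_4\\\beta_1&\beta_2&\beta_3&\beta_4\end{pmatrix}$ of a $2$-dimensional algebra with respect to a basis $(e^1,e^2)$ is defined by $e^1\cdot e^1=\alpha_1e^1+\beta_1e^2$, $e^1\cdot e^2=\alpha_2e^1+\beta_2e^2$, $e^2\cdot e^1=\alpha_3e^1+\beta_3e^2$, $e^2\cdot e^2=\alpha_4e^1+\beta_4e^2$. An algebra is identified with its matrix of structure constants. For $a\in\mathbb{F}$, $\sqrt a$ denotes the (unique, as the characteristic is $2$) square root of $a$ in $\mathbb{F}$. *)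

theory Defs
  imports "HOL-Analysis.Analysis"
begin

text \<open>The underlying space of an algebra is a whole type \<open>'v\<close>; no associativity, commutativity or
  unit is assumed.\<close>

locale nonassoc_algebra = vector_space scale
  for scale :: "'f::field \<Rightarrow> 'v::ab_group_add \<Rightarrow> 'v" +
  fixes mult :: "'v \<Rightarrow> 'v \<Rightarrow> 'v"
  assumes linear_mult_left: "Vector_Spaces.linear scale scale (\<lambda>u. mult u v)"
    and linear_mult_right: "Vector_Spaces.linear scale scale (\<lambda>v. mult u v)"

locale jordan_algebra = nonassoc_algebra scale mult
  for scale :: "'f::field \<Rightarrow> 'v::ab_group_add \<Rightarrow> 'v" and mult :: "'v \<Rightarrow> 'v \<Rightarrow> 'v" +
  assumes jordan: "mult (mult u v) (mult u u) = mult u (mult v (mult u u))"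

definition algebra_isomorphic ::
  "('f::field \<Rightarrow> 'v::ab_group_add \<Rightarrow> 'v) \<Rightarrow> ('v \<Rightarrow> 'v \<Rightarrow> 'v) \<Rightarrow>
   ('f \<Rightarrow> 'w::ab_group_add \<Rightarrow> 'w) \<Rightarrow> ('w \<Rightarrow> 'w \<Rightarrow> 'w) \<Rightarrow> bool" where
  "algebra_isomorphic scale\<^sub>1 mult\<^sub>1 scale\<^sub>2 mult\<^sub>2 \<longleftrightarrow>
    (\<exists>f. Vector_Spaces.linear scale\<^sub>1 scale\<^sub>2 f \<and> bij f \<and>
         (\<forall>u v. f (mult\<^sub>1 u v) = mult\<^sub>2 (f u) (f v)))"

text \<open>The algebra on \<open>'f^2\<close> whose matrix of structure constants in the standard basis is \<open>A\<close>.
  The columns of \<open>A\<close> are the coordinates of the products \<open>e1 e1\<close>, \<open>e1 e2\<close>, \<open>e2 e1\<close>, \<open>e2 e2\<close>, so the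
  product of \<open>u\<close> and \<open>v\<close> is \<open>A\<close> applied to their Kronecker product; see \<open>sc_mult_basis\<close>.\<close>

definition sc_mult :: "'f::field^4^2 \<Rightarrow> 'f^2 \<Rightarrow> 'f^2 \<Rightarrow> 'f^2" where
  "sc_mult A u v = A *v vector [u$1 * v$1, u$1 * v$2, u$2 * v$1, u$2 * v$2]"

lemma sc_mult_basis:
  fixes A :: "'f::field^4^2"
  shows "sc_mult A (axis 1 1) (axis 1 1) = A$1$1 *s axis 1 1 + A$2$1 *s axis 2 1"
    and "sc_mult A (axis 1 1) (axis 2 1) = A$1$2 *s axis 1 1 + A$2$2 *s axis 2 1"
    and "sc_mult A (axis 2 1) (axis 1 1) = A$1$3 *s axis 1 1 + A$2$3 *s axis 2 1"
    and "sc_mult A (axis 2 1) (axis 2 1) = A$1$4 *s axis 1 1 + A$2$4 *s axis 2 1"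
  by (simp_all add: sc_mult_def vec_eq_iff forall_2 matrix_vector_mult_def sum_4 vector_def axis_def)

lemma nonassoc_algebra_sc_mult: "nonassoc_algebra (*s) (sc_mult A)"
  by unfold_locales
     (simp_all add: sc_mult_def vec_eq_iff matrix_vector_mult_def sum_4 vector_def algebra_simps)

text \<open>The square root is used over algebraically closed fields of characteristic 2 only, where it is
  unique; see \<open>char2_sqrt_power2\<close> and \<open>char2_sqrt_unique\<close>.\<close>

definition char2_sqrt :: "'f::field \<Rightarrow> 'f" where
  "char2_sqrt a = (THE b. b^2 = a)"

lemma char2_power2_inj:
  fixes b c :: "'f::field"
  assumes "CHAR('f) = 2" and "b^2 = c^2"
  shows "b = c"
proof -
  have "(2::'f) = 0"
    using of_nat_CHAR[where 'a='f] assms(1) by simp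
  moreover have "(b - c)^2 = 2 * (c^2 - b * c)"
    using assms(2) by (simp add: power2_eq_square algebra_simps)
  ultimately show ?thesis by simp
qed

lemma char2_sqrt_unique:
  fixes a b :: "'f::field"
  assumes "CHAR('f) = 2" and "b^2 = a"
  shows "char2_sqrt a = b"
  unfolding char2_sqrt_def using assms char2_power2_inj by (intro the_equality) auto

lemma char2_sqrt_power2:
  fixes a :: "'f::alg_closed_field"
  assumes "CHAR('f) = 2"
  shows "(char2_sqrt a)^2 = a"
  using nth_root_exists[of 2 a] char2_sqrt_unique[OF assms] by auto

text \<open>The list of algebras, as labels with their matrices: a label includes its parameter, so that
  different values of the parameter are different entries of the list.\<close>

datatype 'f jordan_label =
  J12 | J22 | J32 'f | J42 'f | J52 'f | J62 | J72 | J82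

fun jordan_param_ok :: "'f::field jordan_label \<Rightarrow> bool" where
  "jordan_param_ok (J42 a) \<longleftrightarrow> a^2 + a + 1 \<noteq> 0"
| "jordan_param_ok (J52 a) \<longleftrightarrow> a^2 + a + 1 = 0"
| "jordan_param_ok _ \<longleftrightarrow> True"

fun jordan_matrix :: "'f::field jordan_label \<Rightarrow> 'f^4^2" where
  "jordan_matrix J12 = vector [vector [0, 1, 1, 0],
                               vector [0, 0, 1, 1]]"
| "jordan_matrix J22 = vector [vector [1, 1, 1, 0],
                               vector [0, 0, 0, 1]]"
| "jordan_matrix (J32 a) = vector [vector [a, 0, 0, 0],
                                   vector [0, 1, a + 1, 0]]"
| "jordan_matrix (J42 a) = vector [vector [a, 0, 0, 0],
                                   vector [0, char2_sqrt (a + a^2), a + 1, 0]]"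
| "jordan_matrix (J52 a) = vector [vector [a, 0, 0, 0],
                                   vector [1, 1, a + 1, 0]]"
| "jordan_matrix J62 = vector [vector [1, 0, 0, 0],
                               vector [0, 0, 1, 0]]"
| "jordan_matrix J72 = vector [vector [0, 1, 1, 0],
                               vector [0, 0, 0, 1]]"
| "jordan_matrix J82 = vector [vector [0, 0, 0, 0],
                               vector [1, 0, 0, 0]]"

end

theory Submission
  imports Defs
begin

text \<open>Everything takes place in the given algebra: it is isomorphic to the algebra of a matrix exactly
  if it has a basis with that multiplication table (\<open>isomorphic_if_matrix_table\<close>,
  \<open>matrix_table_if_isomorphic\<close>). So existence means finding a basis with a listed table, and uniqueness
  means reading the label off properties of the algebra that mention no basis.

  Existence. The determinant of \<open>u\<close> and \<open>u\<^sup>2\<close> is a cubic form in the coordinates of \<open>u\<close>, so some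
  \<open>u \<noteq> 0\<close> has \<open>u\<^sup>2\<close> parallel to \<open>u\<close> (\<open>square_parallel_exists\<close>). After scaling, \<open>u\<close> is either an
  idempotent or has square zero. The Jordan identity is cubic in \<open>u\<close>; as the field has more than two
  elements, it may be polarized once (\<open>jordan_linearized\<close>), and its instances at basis vectors are
  polynomial equations in the structure constants.
  For an idempotent \<open>e\<close> the first such equation says that left and right multiplication
  by \<open>e\<close> commute. If not both of them are the identity modulo \<open>e\<close>, they have a common eigenvector \<open>f\<close>
  independent of \<open>e\<close>; then either \<open>f\<^sup>2 = 0\<close>, which is the diagonal
  case \<open>e\<^sup>2 = a e\<close>, \<open>e f = b f\<close>, \<open>f e = d f\<close> with \<open>d = a + b\<close> or \<open>a d = b\<^sup>2\<close>
  (\<open>diagonal_classified\<close>: J3, J4, J6, J7), or the algebra is a sum of two copies of the field (J2). If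
  both are the identity modulo \<open>e\<close>, then \<open>e\<close> is a unit and the algebra is a quadratic extension
  (J2, J7), or it is J1.
  Without nonzero idempotents, every \<open>u\<close> with \<open>u\<^sup>2\<close> parallel to \<open>u\<close> has \<open>u\<^sup>2 = 0\<close>. Two independent such
  vectors again lead to the diagonal case (J3 and J4 with parameter 0); a single one up to scaling
  leads to J5 and J8.

  Uniqueness. The traces of left and right multiplication by \<open>u\<close> are linear forms in \<open>u\<close>. For J6 the
  right trace vanishes and the left one does not, for J7 and J8 both vanish, and for the other
  algebras the left trace is a constant \<open>k\<close> times the nonzero right trace: \<open>k\<close> is \<open>0\<close> for J1, \<open>1\<close> for
  J2, \<open>a + 1\<close> for J3 and J5, and \<open>\<surd>a\<close> for J4, because \<open>a + \<surd>(a + a\<^sup>2) = \<surd>a\<close> in characteristic 2. So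
  \<open>k\<close> recovers the parameter, and the behaviour of squares separates the families
  (\<open>signature_unique\<close>, \<open>matrix_table_signature\<close>).\<close>

section \<open>Bases of a two-dimensional algebra\<close>

context nonassoc_algebra
begin

definition comb :: "'v \<Rightarrow> 'v \<Rightarrow> 'f \<Rightarrow> 'f \<Rightarrow> 'v" where
  "comb e f x y = scale x e + scale y f"

definition frame :: "'v \<Rightarrow> 'v \<Rightarrow> bool" where
  "frame e f \<longleftrightarrow> (\<forall>x y. comb e f x y = 0 \<longrightarrow> x = 0 \<and> y = 0) \<and> (\<forall>v. \<exists>x y. v = comb e f x y)"

definition table ::
  "'v \<Rightarrow> 'v \<Rightarrow> 'f \<Rightarrow> 'f \<Rightarrow> 'f \<Rightarrow> 'f \<Rightarrow> 'f \<Rightarrow> 'f \<Rightarrow> 'f \<Rightarrow> 'f \<Rightarrow> bool" where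
  "table e f a1 a2 a3 a4 b1 b2 b3 b4 \<longleftrightarrow> frame e f \<and>
     mult e e = comb e f a1 b1 \<and> mult e f = comb e f a2 b2 \<and>
     mult f e = comb e f a3 b3 \<and> mult f f = comb e f a4 b4"

definition matrix_table :: "'v \<Rightarrow> 'v \<Rightarrow> 'f^4^2 \<Rightarrow> bool" where
  "matrix_table e f A \<longleftrightarrow>
     table e f (A$1$1) (A$1$2) (A$1$3) (A$1$4) (A$2$1) (A$2$2) (A$2$3) (A$2$4)"

lemma mult_add_left: "mult (u + v) w = mult u w + mult v w"
  and mult_scale_left: "mult (scale c u) w = scale c (mult u w)"
  using linear_mult_left[of w] by (simp_all add: Vector_Spaces.linear_iff)

lemma mult_add_right: "mult w (u + v) = mult w u + mult w v"
  and mult_scale_right: "mult w (scale c u) = scale c (mult w u)"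
  using linear_mult_right[of w] by (simp_all add: Vector_Spaces.linear_iff)

lemma comb_add: "comb e f x y + comb e f z w = comb e f (x + z) (y + w)"
  by (simp add: comb_def scale_left_distrib add_ac)

lemma scale_comb: "scale c (comb e f x y) = comb e f (c * x) (c * y)"
  by (simp add: comb_def scale_right_distrib)

lemma comb_diff: "comb e f x y - comb e f z w = comb e f (x - z) (y - w)"
  by (simp add: comb_def scale_left_diff_distrib)

lemma comb_comb:
  "comb (comb e f x y) (comb e f z w) s t = comb e f (s * x + t * z) (s * y + t * w)"
  using comb_add scale_comb by (simp add: comb_def[of "comb e f x y"])

lemma comb_unit [simp]: "comb e f 1 0 = e" "comb e f 0 1 = f" "comb e f 0 0 = 0"
  by (simp_all add: comb_def)

lemma comb_swap: "comb f e x y = comb e f y x"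
  by (simp add: comb_def add.commute)

lemma comb_eq_iff:
  assumes "frame e f"
  shows "comb e f x y = comb e f z w \<longleftrightarrow> x = z \<and> y = w"
proof
  assume "comb e f x y = comb e f z w"
  then have "comb e f (x - z) (y - w) = 0"
    by (simp flip: comb_diff)
  then show "x = z \<and> y = w"
    using assms by (metis frame_def eq_iff_diff_eq_0)
qed simp

lemma comb_eq_0_iff: "frame e f \<Longrightarrow> comb e f x y = 0 \<longleftrightarrow> x = 0 \<and> y = 0"
  using comb_eq_iff[of e f x y 0 0] by simp

lemma frame_coords:
  assumes "frame e f"
  obtains x y where "v = comb e f x y"
  using assms unfolding frame_def by blast

text \<open>Cramer's rule.\<close>

lemma frame_comb:
  assumes ef: "frame e f" and det: "x * w - y * z \<noteq> 0"
  shows "frame (comb e f x y) (comb e f z w)"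
  unfolding frame_def comb_comb
proof (intro conjI allI impI)
  fix s t
  assume "comb e f (s * x + t * z) (s * y + t * w) = 0"
  then have 1: "s * x + t * z = 0" and 2: "s * y + t * w = 0"
    using comb_eq_0_iff[OF ef] by auto
  have "s * (x * w - y * z) = w * (s * x + t * z) - z * (s * y + t * w)"
    by (simp add: algebra_simps)
  then show "s = 0" using 1 2 det by simp
  have "t * (x * w - y * z) = x * (s * y + t * w) - y * (s * x + t * z)"
    by (simp add: algebra_simps)
  then show "t = 0" using 1 2 det by simp
next
  fix v
  obtain p q where v: "v = comb e f p q" using frame_coords[OF ef] .
  let ?d = "x * w - y * z"
  have "(p * w - q * z) / ?d * x + (q * x - p * y) / ?d * z = (p * ?d) / ?d"
    by (simp add: add_divide_distrib[symmetric] algebra_simps)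
  moreover have "(p * w - q * z) / ?d * y + (q * x - p * y) / ?d * w = (q * ?d) / ?d"
    by (simp add: add_divide_distrib[symmetric] algebra_simps)
  ultimately show "\<exists>s t. v = comb e f (s * x + t * z) (s * y + t * w)"
    using det v by (metis nonzero_mult_div_cancel_right)
qed

lemma frame_swap: "frame e f \<Longrightarrow> frame f e"
  using frame_comb[of e f 0 0 1 1] by simp

lemma frame_scale: "frame e f \<Longrightarrow> x \<noteq> 0 \<Longrightarrow> y \<noteq> 0 \<Longrightarrow> frame (comb e f x 0) (comb e f 0 y)"
  using frame_comb[of e f x y 0 0] by simp

lemma frame_shift: "frame e f \<Longrightarrow> frame e (comb e f t 1)"
  using frame_comb[of e f 1 1 0 t] by simp

lemma extend_to_frame:
  assumes "frame e f" "u \<noteq> 0"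
  obtains v where "frame u v"
proof -
  obtain x y where u: "u = comb e f x y" using frame_coords[OF assms(1)] .
  show thesis
  proof (cases "x = 0")
    case True
    then have "y \<noteq> 0" using u assms(2) by auto
    then show thesis using frame_comb[OF assms(1), of x 0 y 1] u that by simp
  next
    case False
    then show thesis using frame_comb[OF assms(1), of x 1 y 0] u that by simp
  qed
qed

lemma frame_obtain_table:
  assumes "frame e f"
  obtains a1 a2 a3 a4 b1 b2 b3 b4 where "table e f a1 a2 a3 a4 b1 b2 b3 b4"
  using assms unfolding table_def by (metis frame_coords)

lemma table_frame: "table e f a1 a2 a3 a4 b1 b2 b3 b4 \<Longrightarrow> frame e f"
  by (simp add: table_def)

lemma mult_comb:
  assumes "table e f a1 a2 a3 a4 b1 b2 b3 b4"
  shows "mult (comb e f x y) (comb e f z w) =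
    comb e f (a1 * x * z + a2 * x * w + a3 * y * z + a4 * y * w)
             (b1 * x * z + b2 * x * w + b3 * y * z + b4 * y * w)"
proof -
  have "mult (comb e f x y) (comb e f z w) =
    scale (x * z) (mult e e) + scale (x * w) (mult e f) +
    scale (y * z) (mult f e) + scale (y * w) (mult f f)"
    unfolding comb_def
    by (simp add: mult_add_left mult_add_right mult_scale_left mult_scale_right
      scale_right_distrib algebra_simps)
  then show ?thesis
    using assms by (simp add: table_def scale_comb comb_add algebra_simps)
qed

lemma frame_exists:
  assumes "dim (UNIV :: 'v set) = 2"
  obtains e f where "frame e f"
proof -
  obtain B :: "'v set" where B: "independent B" "UNIV \<subseteq> span B" "card B = 2"
    using basis_exists[of UNIV] assms by metis
  then obtain e f where ef: "B = {e, f}" "e \<noteq> f"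
    by (meson card_2_iff)
  have "frame e f"
    unfolding frame_def
  proof (intro conjI allI impI)
    fix x y assume "comb e f x y = 0"
    then have "(\<Sum>v\<in>B. scale (if v = e then x else y) v) = 0"
      using ef by (simp add: comb_def)
    then have *: "\<forall>v\<in>B. (if v = e then x else y) = 0"
      using independentD[OF B(1), of B "\<lambda>v. if v = e then x else y"] ef by auto
    then show "x = 0" "y = 0" using ef by auto
  next
    fix v
    have "v \<in> span {e, f}" using B ef by auto
    then obtain x where "v - scale x e \<in> span {f}"
      by (auto simp: span_insert)
    then obtain y where "v - scale x e = scale y f"
      by (auto simp: span_singleton)
    then show "\<exists>x y. v = comb e f x y"
      by (metis comb_def diff_add_cancel add.commute)
  qed
  then show thesis using that by blast
qed

lemma isomorphic_if_matrix_table: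
  assumes "matrix_table e f A"
  shows "algebra_isomorphic scale mult (*s) (sc_mult A)"
proof -
  have tab: "table e f (A$1$1) (A$1$2) (A$1$3) (A$1$4) (A$2$1) (A$2$2) (A$2$3) (A$2$4)"
    using assms by (simp add: matrix_table_def)
  note ef = table_frame[OF tab]
  let ?g = "\<lambda>p :: 'f^2. comb e f (p$1) (p$2)"
  have bij: "bij ?g"
  proof (rule bijI)
    show "inj ?g"
      by (rule injI) (simp add: comb_eq_iff[OF ef] vec_eq_iff forall_2)
    show "surj ?g"
    proof (rule surjI)
      fix v
      obtain x y where "v = comb e f x y" using frame_coords[OF ef] .
      then show "?g (SOME p. ?g p = v) = v"
        using someI[of "\<lambda>p. ?g p = v" "vector [x, y]"] by simp
    qed
  qed
  let ?h = "inv ?g"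
  have gh: "?g (?h v) = v" for v
    using surj_f_inv_f[OF bij_is_surj[OF bij]] .
  have hg: "?h (?g p) = p" for p
    using inv_f_f[OF bij_is_inj[OF bij]] .
  have g_add: "?g (p + q) = ?g p + ?g q" and g_scale: "?g (c *s p) = scale c (?g p)" for p q c
    by (simp_all add: comb_add scale_comb)
  have g_mult: "?g (sc_mult A p q) = mult (?g p) (?g q)" for p q
    unfolding mult_comb[OF tab]
    by (simp add: sc_mult_def matrix_vector_mult_def sum_4 vector_def algebra_simps)
  have "Vector_Spaces.linear scale (*s) ?h"
  proof (unfold Vector_Spaces.linear_iff, intro conjI allI)
    show "vector_space scale" by unfold_locales
    show "vector_space ((*s) :: 'f \<Rightarrow> 'f^2 \<Rightarrow> 'f^2)" by unfold_locales
    show "?h (u + v) = ?h u + ?h v" for u v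
      using hg[of "?h u + ?h v"] by (simp only: g_add gh)
    show "?h (scale c u) = c *s ?h u" for c u
      using hg[of "c *s ?h u"] by (simp only: g_scale gh)
  qed
  moreover have "bij ?h" using bij by (rule bij_imp_bij_inv)
  moreover have "?h (mult u v) = sc_mult A (?h u) (?h v)" for u v
    using hg[of "sc_mult A (?h u) (?h v)"] by (simp only: g_mult gh)
  ultimately show ?thesis
    unfolding algebra_isomorphic_def by blast
qed

lemma matrix_table_if_isomorphic:
  assumes "algebra_isomorphic scale mult (*s) (sc_mult A)"
  obtains e f where "matrix_table e f A"
proof -
  obtain h where lin: "Vector_Spaces.linear scale (*s) h" and bij: "bij h"
    and h_mult: "\<And>u v. h (mult u v) = sc_mult A (h u) (h v)"
    using assms unfolding algebra_isomorphic_def by blast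
  obtain e f where e: "h e = axis 1 1" and f: "h f = axis 2 1"
    using bij by (metis bij_pointE)
  have h_comb: "h (comb e f x y) = x *s axis 1 1 + y *s axis 2 1" for x y
    using lin e f by (simp add: comb_def Vector_Spaces.linear_iff)
  have h0: "h 0 = 0"
    using h_comb[of 0 0] by simp
  have eqI: "u = v" if "h u = h v" for u v
    using that bij by (simp add: bij_def inj_def)
  have "frame e f"
    unfolding frame_def
  proof (intro conjI allI impI)
    fix x y assume "comb e f x y = 0"
    then have "x *s axis 1 1 + y *s axis 2 1 = (0 :: 'f^2)"
      using h_comb h0 by metis
    then show "x = 0" "y = 0"
      by (simp_all add: vec_eq_iff forall_2 axis_def)
  next
    fix v
    have "h v = h (comb e f (h v $ 1) (h v $ 2))"
      unfolding h_comb by (simp add: vec_eq_iff forall_2 axis_def)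
    then show "\<exists>x y. v = comb e f x y" using eqI by blast
  qed
  then have "matrix_table e f A"
    unfolding matrix_table_def table_def
    by (auto intro!: eqI simp: h_mult h_comb e f sc_mult_basis)
  then show thesis using that by blast
qed

section \<open>Traces of the multiplication operators\<close>

text \<open>The description is meaningful for linear operators only: for them the sum of the diagonal
  entries is the same in every basis, by \<open>trace_basis_independent\<close>.\<close>

definition operator_trace :: "('v \<Rightarrow> 'v) \<Rightarrow> 'f" where
  "operator_trace T = (THE s. \<exists>e f a b c d.
     frame e f \<and> T e = comb e f a b \<and> T f = comb e f c d \<and> s = a + d)"

abbreviation left_trace :: "'v \<Rightarrow> 'f" where
  "left_trace u \<equiv> operator_trace (mult u)"

abbreviation right_trace :: "'v \<Rightarrow> 'f" where
  "right_trace u \<equiv> operator_trace (\<lambda>v. mult v u)"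

lemma trace_basis_independent:
  assumes ef: "frame e f" and ef': "frame e' f'"
    and add: "\<And>u v. T (u + v) = T u + T v" and scale: "\<And>c u. T (scale c u) = scale c (T u)"
    and T: "T e = comb e f a b" "T f = comb e f c d"
    and T': "T e' = comb e' f' a' b'" "T f' = comb e' f' c' d'"
  shows "a' + d' = a + d"
proof -
  obtain x y where e': "e' = comb e f x y" using frame_coords[OF ef] .
  obtain z w where f': "f' = comb e f z w" using frame_coords[OF ef] .
  have det: "x * w - y * z \<noteq> 0"
  proof
    assume 0: "x * w - y * z = 0"
    have "comb e' f' w (- y) = 0" "comb e' f' (- z) x = 0"
      using 0 unfolding e' f' comb_comb by (simp_all add: mult.commute)
    then have "y = 0 \<and> w = 0 \<and> z = 0 \<and> x = 0"
      using comb_eq_0_iff[OF ef'] by auto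
    then have "e' = 0" using e' by simp
    then have "comb e' f' 1 0 = 0" by simp
    then show False using comb_eq_0_iff[OF ef', of 1 0] by simp
  qed
  have T_comb: "T (comb e f s t) = comb e f (s * a + t * c) (s * b + t * d)" for s t
    using comb_comb[of e f a b c d s t] T by (simp add: comb_def[of e f s] add scale comb_def)
  have 1: "x * a + y * c = a' * x + b' * z" and 2: "x * b + y * d = a' * y + b' * w"
    using T'(1) unfolding e' f' comb_comb T_comb comb_eq_iff[OF ef] by auto
  have 3: "z * a + w * c = c' * x + d' * z" and 4: "z * b + w * d = c' * y + d' * w"
    using T'(2) unfolding e' f' comb_comb T_comb comb_eq_iff[OF ef] by auto
  \<comment> \<open>Each diagonal entry in the new basis, times the determinant, is a combination (again by Cramer's
    rule) of two of the four equations; the off-diagonal entries cancel in the sum.\<close>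
  have "(a' + d') * (x * w - y * z) =
      w * (a' * x + b' * z) - z * (a' * y + b' * w) + x * (c' * y + d' * w) - y * (c' * x + d' * z)"
    by (simp add: algebra_simps)
  also have "\<dots> = (a + d) * (x * w - y * z)"
    unfolding 1[symmetric] 2[symmetric] 3[symmetric] 4[symmetric] by (simp add: algebra_simps)
  finally show ?thesis using det by simp
qed

lemma operator_trace_eq:
  assumes "frame e f" "\<And>u v. T (u + v) = T u + T v" "\<And>c u. T (scale c u) = scale c (T u)"
    and "T e = comb e f a b" "T f = comb e f c d"
  shows "operator_trace T = a + d"
  unfolding operator_trace_def
proof (rule the_equality)
  show "\<exists>e f a' b c d'. frame e f \<and> T e = comb e f a' b \<and> T f = comb e f c d' \<and> a + d = a' + d'"
    using assms by blast
qed (use trace_basis_independent[OF assms(1) _ assms(2,3) assms(4,5)] in blast)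

lemma trace_comb:
  assumes "table e f a1 a2 a3 a4 b1 b2 b3 b4"
  shows "left_trace (comb e f x y) = x * (a1 + b2) + y * (a3 + b4)"
    and "right_trace (comb e f x y) = x * (a1 + b3) + y * (a2 + b4)"
proof -
  note mult = mult_comb[OF assms]
  have "left_trace (comb e f x y) = (a1 * x + a3 * y) + (b2 * x + b4 * y)"
    using mult[of x y 1 0] mult[of x y 0 1]
    by (intro operator_trace_eq[OF table_frame[OF assms]])
       (simp_all add: mult_add_right mult_scale_right)
  then show "left_trace (comb e f x y) = x * (a1 + b2) + y * (a3 + b4)"
    by (simp add: algebra_simps)
  have "right_trace (comb e f x y) = (a1 * x + a2 * y) + (b3 * x + b4 * y)"
    using mult[of 1 0 x y] mult[of 0 1 x y]
    by (intro operator_trace_eq[OF table_frame[OF assms]])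
       (simp_all add: mult_add_left mult_scale_left)
  then show "right_trace (comb e f x y) = x * (a1 + b3) + y * (a2 + b4)"
    by (simp add: algebra_simps)
qed

end

section \<open>Uniqueness\<close>

locale char2_jordan_algebra = jordan_algebra scale mult
  for scale :: "'f::alg_closed_field \<Rightarrow> 'v::ab_group_add \<Rightarrow> 'v" and mult :: "'v \<Rightarrow> 'v \<Rightarrow> 'v" +
  assumes char2: "CHAR('f) = 2"
begin

lemma add_self [simp]: "(a::'f) + a = 0"
  using of_nat_CHAR[where 'a='f] char2 by (simp flip: mult_2)

lemma add_self_left [simp]: "(a::'f) + (a + b) = b"
  by (simp flip: add.assoc)

lemma add_eq_0_iff_eq: "(a::'f) + b = 0 \<longleftrightarrow> a = b"
  by (metis add_self add_left_cancel)

lemma power2_add: "((a::'f) + b)^2 = a^2 + b^2"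
  by (simp add: power2_eq_square algebra_simps)

text \<open>Writing \<open>a = c\<^sup>2\<close> makes the table of J4 polynomial in \<open>c\<close>.\<close>

lemma sqrt_entry: "char2_sqrt (c^2 + (c^2)^2) = (c::'f) + c^2"
  using char2_sqrt_unique[OF char2, of "c + c^2"] by (simp add: power2_add)

definition trace_ratio :: "'f \<Rightarrow> bool" where
  "trace_ratio k \<longleftrightarrow> (\<exists>u. right_trace u \<noteq> 0) \<and> (\<forall>u. left_trace u = k * right_trace u)"

definition square_parallel :: "'v \<Rightarrow> bool" where
  "square_parallel u \<longleftrightarrow> (\<exists>k. mult u u = scale k u)"

definition trace_kernel_square_zero :: bool where
  "trace_kernel_square_zero \<longleftrightarrow> (\<forall>u. right_trace u = 0 \<longrightarrow> mult u u = 0)"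

text \<open>The basis-free properties that single out each label. The trace ratio identifies the parameter.
  The square of the vectors in the kernel of the right trace separates J1 and J2 from J3, J4 and J5;
  and among these three, \<open>u\<^sup>2\<close> is parallel to \<open>u\<close> for every \<open>u\<close> in J3, for some but not all \<open>u\<close>
  outside the kernel in J4, and for no such \<open>u\<close> in J5.\<close>

fun signature :: "'f jordan_label \<Rightarrow> bool" where
  "signature J12 \<longleftrightarrow> trace_ratio 0 \<and> \<not> trace_kernel_square_zero"
| "signature J22 \<longleftrightarrow> trace_ratio 1 \<and> \<not> trace_kernel_square_zero"
| "signature (J32 a) \<longleftrightarrow> trace_ratio (a + 1) \<and> trace_kernel_square_zero \<and> (\<forall>u. square_parallel u)"
| "signature (J42 a) \<longleftrightarrow> (\<exists>c. a = c^2 \<and> trace_ratio c) \<and> trace_kernel_square_zero \<and>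
     \<not> (\<forall>u. square_parallel u) \<and> (\<exists>u. right_trace u \<noteq> 0 \<and> square_parallel u)"
| "signature (J52 a) \<longleftrightarrow> trace_ratio (a + 1) \<and> trace_kernel_square_zero \<and>
     \<not> (\<exists>u. right_trace u \<noteq> 0 \<and> square_parallel u)"
| "signature J62 \<longleftrightarrow> (\<forall>u. right_trace u = 0) \<and> (\<exists>u. left_trace u \<noteq> 0)"
| "signature J72 \<longleftrightarrow> (\<forall>u. right_trace u = 0 \<and> left_trace u = 0) \<and>
     (\<exists>u. mult (mult u u) (mult u u) \<noteq> 0)"
| "signature J82 \<longleftrightarrow> (\<forall>u. right_trace u = 0 \<and> left_trace u = 0) \<and>
     (\<forall>u. mult (mult u u) (mult u u) = 0)"

lemma trace_ratio_unique: "trace_ratio k \<Longrightarrow> trace_ratio k' \<Longrightarrow> k = k'"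
  unfolding trace_ratio_def by (metis mult_cancel_right)

lemma signature_unique:
  assumes "signature L" "signature L'"
  shows "L = L'"
proof -
  have no_ratio: "\<not> trace_ratio k" if "\<forall>u. right_trace u = 0" for k
    using that by (simp add: trace_ratio_def)
  have ex: "\<exists>u. right_trace u \<noteq> 0" if "trace_ratio k" for k
    using that by (simp add: trace_ratio_def)
  have "trace_ratio 0 \<Longrightarrow> \<not> trace_ratio 1"
    using trace_ratio_unique[of 0 1] by auto
  then show ?thesis
    using assms
    by (cases L; cases L'; simp; metis no_ratio ex trace_ratio_unique add_right_cancel)
qed

lemma all_iff_comb: "frame e f \<Longrightarrow> (\<forall>u. P u) \<longleftrightarrow> (\<forall>x y. P (comb e f x y))"
  by (metis frame_coords)

lemma ex_iff_comb: "frame e f \<Longrightarrow> (\<exists>u. P u) \<longleftrightarrow> (\<exists>x y. P (comb e f x y))"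
  by (metis frame_coords)

text \<open>The parameter conditions enter here: if \<open>a\<^sup>2 + a + 1 = 0\<close> then every square in the algebra J4
  would be parallel to its root, as in J3; and J5 has \<open>a \<noteq> 0\<close>.\<close>

lemma matrix_table_signature:
  assumes ok: "jordan_param_ok L" and tab: "matrix_table e f (jordan_matrix L)"
  shows "signature L"
proof -
  note T = tab[unfolded matrix_table_def]
  have ef: "frame e f" using T by (rule table_frame)
  note coords = trace_ratio_def square_parallel_def trace_kernel_square_zero_def
    all_iff_comb[OF ef] ex_iff_comb[OF ef] trace_comb[OF T] mult_comb[OF T] scale_comb
    comb_eq_iff[OF ef] comb_eq_0_iff[OF ef]
  show ?thesis
  proof (cases L)
    case J12
    show ?thesis unfolding J12 signature.simps coords
      by (simp add: J12 vector_def exI[of _ 1])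
  next
    case J22
    show ?thesis unfolding J22 signature.simps coords
      by (simp add: J22 vector_def exI[of _ 1])
  next
    case (J32 a)
    show ?thesis unfolding J32 signature.simps coords
      by (auto simp: J32 vector_def algebra_simps intro: exI[of _ 1])
  next
    case (J42 a)
    define c where "c = char2_sqrt a"
    have a: "a = c^2" using char2_sqrt_power2[OF char2] by (simp add: c_def)
    have "(c^2 + c + 1)^2 \<noteq> 0"
      using ok by (simp add: J42 a power2_add)
    then have c: "c^2 + c + 1 \<noteq> 0" by simp
    have T: "table e f (c^2) 0 0 0 0 (c + c^2) (c^2 + 1) 0"
      using T sqrt_entry[of c] by (simp add: J42 vector_def a)
    have square: "mult (comb e f x y) (comb e f x y) = comb e f (c^2 * x^2) ((c + 1) * x * y)" for x y
      by (simp add: mult_comb[OF T] power2_eq_square algebra_simps)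
    have left: "left_trace (comb e f x y) = c * x"
      and right: "right_trace (comb e f x y) = x" for x y
      using trace_comb[OF T, of x y] by (simp_all add: algebra_simps)
    have "trace_ratio c"
      by (auto simp: trace_ratio_def all_iff_comb[OF ef] ex_iff_comb[OF ef] left right intro: exI[of _ 1])
    moreover have trace_kernel_square_zero
      by (simp add: trace_kernel_square_zero_def all_iff_comb[OF ef] right square)
    moreover have "square_parallel (comb e f 1 0)"
      using square[of 1 0] by (auto simp: square_parallel_def comb_def)
    moreover have "right_trace (comb e f 1 0) \<noteq> 0" using right[of 1 0] by simp
    moreover have "\<not> square_parallel (comb e f 1 1)"
      using square[of 1 1] c add_eq_0_iff_eq[of "c^2" "c + 1"]
      by (auto simp: square_parallel_def scale_comb comb_eq_iff[OF ef] add.assoc)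
    ultimately show ?thesis unfolding J42 signature.simps using a by blast
  next
    case (J52 a)
    have a: "a \<noteq> 0" using ok by (auto simp: J52)
    have T: "table e f a 0 0 0 1 1 (a + 1) 0"
      using T by (simp add: J52 vector_def)
    have square: "mult (comb e f x y) (comb e f x y) = comb e f (a * x^2) (x^2 + a * x * y)" for x y
      by (simp add: mult_comb[OF T] power2_eq_square algebra_simps)
    have left: "left_trace (comb e f x y) = (a + 1) * x"
      and right: "right_trace (comb e f x y) = x" for x y
      using trace_comb[OF T, of x y] by (simp_all add: algebra_simps)
    have "trace_ratio (a + 1)"
      by (auto simp: trace_ratio_def all_iff_comb[OF ef] ex_iff_comb[OF ef] left right intro: exI[of _ 1])
    moreover have trace_kernel_square_zero
      by (simp add: trace_kernel_square_zero_def all_iff_comb[OF ef] right square)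
    moreover have "x = 0" if par: "square_parallel (comb e f x y)" for x y
    proof -
      obtain k where k: "a * x^2 = k * x" "x^2 + a * x * y = k * y"
        using par unfolding square_parallel_def square scale_comb comb_eq_iff[OF ef] by blast
      show "x = 0"
      proof (rule ccontr)
        assume "x \<noteq> 0"
        then have "k = a * x" using k(1) by (simp add: power2_eq_square)
        then show False using k(2) \<open>x \<noteq> 0\<close> by simp
      qed
    qed
    then have "\<not> (\<exists>u. right_trace u \<noteq> 0 \<and> square_parallel u)"
      by (auto simp: ex_iff_comb[OF ef] right)
    ultimately show ?thesis by (simp add: J52)
  next
    case J62
    show ?thesis unfolding J62 signature.simps coords
      by (simp add: J62 vector_def exI[of _ 1])
  next
    case J72
    show ?thesis unfolding J72 signature.simps coords
      by (simp add: J72 vector_def) (rule exI[of _ 0], rule exI[of _ 1], simp)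
  next
    case J82
    show ?thesis unfolding J82 signature.simps coords
      by (simp add: J82 vector_def)
  qed
qed

section \<open>Existence\<close>

definition classified :: bool where
  "classified \<longleftrightarrow> (\<exists>L e f. jordan_param_ok L \<and> matrix_table e f (jordan_matrix L))"

lemma classifiedI:
  "jordan_param_ok L \<Longrightarrow> matrix_table e f (jordan_matrix L) \<Longrightarrow> classified"
  unfolding classified_def by blast

lemma table_swap:
  "table e f a1 a2 a3 a4 b1 b2 b3 b4 \<Longrightarrow> table f e b4 b3 b2 b1 a4 a3 a2 a1"
  unfolding table_def comb_swap[of f e] by (simp add: frame_swap)

lemma table_scale:
  assumes T: "table e f a1 a2 a3 a4 b1 b2 b3 b4" and "x \<noteq> 0" "y \<noteq> 0"
  shows "table (comb e f x 0) (comb e f 0 y) (x * a1) (y * a2) (y * a3) (y^2 * a4 / x)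
    (x^2 * b1 / y) (x * b2) (x * b3) (y * b4)"
  unfolding table_def mult_comb[OF T] comb_comb comb_eq_iff[OF table_frame[OF T]]
  using frame_scale[OF table_frame[OF T]] assms(2,3) by (simp add: power2_eq_square)

text \<open>The case into which most branches of the classification lead. If \<open>d = a + b\<close>, scaling to \<open>b = 1\<close>
  gives J3, or J6 for \<open>b = 0\<close>. If \<open>a d = b\<^sup>2\<close>, scaling to \<open>a + d = 1\<close> gives J4, which for
  \<open>a\<^sup>2 + a + 1 = 0\<close> coincides with J3; and \<open>a = d\<close> forces \<open>a = b = d\<close>, where \<open>e\<close> is a multiple of a
  unit and the algebra is J7.\<close>

lemma diagonal_classified:
  assumes T: "table e f a 0 0 0 0 b d 0" and nonzero: "a \<noteq> 0 \<or> b \<noteq> 0 \<or> d \<noteq> 0"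
    and ad: "d = a + b \<or> a * d = b^2"
  shows classified
proof (cases "d = a + b")
  case d: True
  show ?thesis
  proof (cases "b = 0")
    case True
    then have "a \<noteq> 0" using nonzero d by auto
    then show ?thesis
      using table_scale[OF T, of "1/a" 1] d True
      by (intro classifiedI[of J62]) (simp_all add: matrix_table_def vector_def)
  next
    case False
    then show ?thesis
      using table_scale[OF T, of "1/b" 1] d
      by (intro classifiedI[of "J32 (a/b)"])
        (simp_all add: matrix_table_def vector_def add_divide_distrib)
  qed
next
  case False
  with ad have ad: "a * d = b^2" by blast
  show ?thesis
  proof (cases "a = d")
    case True
    then have "a = b"
      using ad char2_power2_inj[OF char2, of a b] by (simp add: power2_eq_square)
    then show ?thesis
      using table_swap[OF table_scale[OF T, of "1/a" 1]] True nonzero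
      by (intro classifiedI[of J72]) (simp_all add: matrix_table_def vector_def)
  next
    case False
    then have ne: "a + d \<noteq> 0" by (simp add: add_eq_0_iff_eq)
    define k where "k = a / (a + d)"
    have dk: "d / (a + d) = k + 1"
    proof -
      have "k + d / (a + d) = 1" using ne by (simp add: k_def flip: add_divide_distrib)
      then show ?thesis by (metis add_self_left)
    qed
    have "k + k^2 = k * (d / (a + d))" by (simp add: dk power2_eq_square algebra_simps)
    also have "\<dots> = (b / (a + d))^2"
      by (simp add: k_def power_divide flip: ad) (simp add: power2_eq_square)
    finally have bk: "(b / (a + d))^2 = k + k^2" by simp
    have T': "table (comb e f (1/(a+d)) 0) (comb e f 0 1) k 0 0 0 0 (b/(a+d)) (k+1) 0"
      using table_scale[OF T, of "1/(a+d)" 1] ne dk by (simp add: k_def)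
    show ?thesis
    proof (cases "k^2 + k + 1 = 0")
      case True
      then have "(b / (a + d))^2 = 1^2"
        using bk by (simp add: add_eq_0_iff_eq add.commute)
      then have "b / (a + d) = 1"
        by (rule char2_power2_inj[OF char2])
      then show ?thesis
        using T' by (intro classifiedI[of "J32 k"]) (simp_all add: matrix_table_def vector_def)
    next
      case False
      then show ?thesis
        using T' char2_sqrt_unique[OF char2 bk]
        by (intro classifiedI[of "J42 k"]) (simp_all add: matrix_table_def vector_def)
    qed
  qed
qed

lemma quadratic_root:
  assumes "(r::'f) \<noteq> 0"
  obtains x where "r * x^2 + q * x + p = 0"
proof -
  obtain x where "(\<Sum>k\<le>2. [p, q, r] ! k * x^k) = 0"
    using alg_closed[of 2 "\<lambda>k. [p, q, r] ! k"] assms by auto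
  then show thesis
    using that by (simp add: numeral_2_eq_2 algebra_simps)
qed

lemma cubic_root:
  assumes "(s::'f) \<noteq> 0"
  obtains x where "s * x^3 + r * x^2 + q * x + p = 0"
proof -
  obtain x where "(\<Sum>k\<le>3. [p, q, r, s] ! k * x^k) = 0"
    using alg_closed[of 3 "\<lambda>k. [p, q, r, s] ! k"] assms by auto
  then show thesis
    using that by (simp add: numeral_2_eq_2 numeral_3_eq_3 algebra_simps)
qed

text \<open>The cubic in the proof is the determinant of \<open>u\<close> and \<open>u\<^sup>2\<close> for \<open>u = x e + f\<close>. Its leading
  coefficient vanishes exactly if \<open>e\<close> itself has the required property.\<close>

lemma square_parallel_exists:
  assumes "frame e f"
  obtains u where "u \<noteq> 0" "square_parallel u"
proof -
  obtain a1 a2 a3 a4 b1 b2 b3 b4 where T: "table e f a1 a2 a3 a4 b1 b2 b3 b4"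
    using frame_obtain_table[OF assms] .
  show thesis
  proof (cases "b1 = 0")
    case True
    then have "mult e e = scale a1 e" using T by (simp add: table_def comb_def)
    moreover have "e \<noteq> 0" using comb_eq_0_iff[OF assms, of 1 0] by auto
    ultimately show thesis using that by (auto simp: square_parallel_def)
  next
    case False
    then obtain x where x: "b1 * x^3 + (b2 + b3 + a1) * x^2 + (b4 + a2 + a3) * x + a4 = 0"
      by (rule cubic_root)
    let ?m = "b1 * x^2 + (b2 + b3) * x + b4"
    have "?m * x + (a1 * x^2 + (a2 + a3) * x + a4) =
        b1 * x^3 + (b2 + b3 + a1) * x^2 + (b4 + a2 + a3) * x + a4"
      by (simp add: power2_eq_square power3_eq_cube algebra_simps)
    then have "a1 * x^2 + (a2 + a3) * x + a4 = ?m * x"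
      unfolding x add_eq_0_iff_eq by (rule sym)
    moreover have "a1 * x * x + a2 * x * 1 + a3 * 1 * x + a4 * 1 * 1 = a1 * x^2 + (a2 + a3) * x + a4"
      "b1 * x * x + b2 * x * 1 + b3 * 1 * x + b4 * 1 * 1 = ?m * 1"
      by (simp_all add: power2_eq_square algebra_simps)
    ultimately have "mult (comb e f x 1) (comb e f x 1) = scale ?m (comb e f x 1)"
      unfolding mult_comb[OF T] scale_comb by simp
    moreover have "comb e f x 1 \<noteq> 0" using comb_eq_0_iff[OF assms] by simp
    ultimately show thesis using that by (auto simp: square_parallel_def)
  qed
qed

text \<open>The Jordan identity at \<open>u + t w\<close> says \<open>t P + t\<^sup>2 Q = 0\<close>, where \<open>P\<close> and \<open>Q\<close> are its parts of
  degree one and two in \<open>w\<close>. Two different nonzero values of \<open>t\<close> give \<open>P = 0\<close>.\<close>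

lemma jordan_linearized:
  "mult (mult u v) (mult u w + mult w u) + mult (mult w v) (mult u u) =
   mult u (mult v (mult u w + mult w u)) + mult w (mult v (mult u u))"
proof -
  define G where "G x y z = mult (mult x v) (mult y z) - mult x (mult v (mult y z))" for x y z
  have G_add: "G (x + x') y z = G x y z + G x' y z" "G x (y + y') z = G x y z + G x y' z"
    "G x y (z + z') = G x y z + G x y z'" for x x' y y' z z'
    unfolding G_def by (simp_all add: mult_add_left mult_add_right)
  have G_scale: "G (scale t x) y z = scale t (G x y z)" "G x (scale t y) z = scale t (G x y z)"
    "G x y (scale t z) = scale t (G x y z)" for t x y z
    unfolding G_def by (simp_all add: mult_scale_left mult_scale_right scale_right_diff_distrib)
  have D: "G x x x = 0" for x by (simp add: G_def jordan)
  define P where "P = G u u w + G u w u + G w u u"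
  define Q where "Q = G u w w + G w u w + G w w u"
  have "G (u + scale t w) (u + scale t w) (u + scale t w) =
      G u u u + scale t P + scale (t * t) Q + scale (t * t * t) (G w w w)" for t
    unfolding P_def Q_def by (simp add: G_add G_scale scale_right_distrib algebra_simps)
  then have PQ: "scale t P + scale (t * t) Q = 0" for t
    by (simp add: D)
  \<comment> \<open>A primitive cube root of unity is a scalar other than 0 and 1.\<close>
  obtain t :: 'f where "1 * t^2 + 1 * t + 1 = 0" using quadratic_root[of 1 1 1] by auto
  then have t: "t \<noteq> 0" "t \<noteq> 1" by auto
  have P: "P = - Q" using PQ[of 1] by (simp add: eq_neg_iff_add_eq_0)
  then have "scale (t * t - t) Q = 0" using PQ[of t] by (simp add: scale_left_diff_distrib)
  moreover have "t * t - t \<noteq> 0" using t by simp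
  ultimately have "P = 0" using P by simp
  then have "G u u w + G u w u + G w u u = 0" by (simp add: P_def)
  then show ?thesis unfolding G_def by (simp add: mult_add_right algebra_simps)
qed

text \<open>A unital algebra is generated by \<open>f\<close>, whose minimal polynomial is \<open>X\<^sup>2 + q X + p\<close>. Shifting \<open>f\<close> by a
  root gives \<open>g\<^sup>2 = q g\<close>: dual numbers (J7) if \<open>q = 0\<close>, two copies of the field (J2) otherwise.\<close>

lemma unital_classified:
  assumes T: "table e f 1 0 0 p 0 1 1 q"
  shows classified
proof -
  have ef: "frame e f" using T by (rule table_frame)
  obtain r where r: "1 * r^2 + q * r + p = 0" using quadratic_root[of 1] by auto
  then have r: "r * r = p + q * r"
    by (simp add: power2_eq_square add_eq_0_iff_eq algebra_simps)
  let ?g = "comb e f r 1"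
  have "mult e ?g = ?g" "mult ?g e = ?g"
    using mult_comb[OF T, of 1 0 r 1] mult_comb[OF T, of r 1 1 0] by simp_all
  moreover have "mult ?g ?g = comb e f (q * r) q"
    unfolding mult_comb[OF T] by (simp add: r algebra_simps)
  moreover have "mult e e = e" using T by (simp add: table_def)
  ultimately have T': "table ?g e q 1 1 0 0 0 0 1"
    using frame_swap[OF frame_shift[OF ef, of r]] comb_comb[of e f r 1 1 0 q 0]
    by (simp add: table_def)
  show ?thesis
  proof (cases "q = 0")
    case True
    then show ?thesis
      using T' by (intro classifiedI[of J72]) (simp_all add: matrix_table_def vector_def)
  next
    case False
    then show ?thesis
      using table_scale[OF T', of "1/q" 1]
      by (intro classifiedI[of J22]) (simp_all add: matrix_table_def vector_def)
  qed
qed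

text \<open>Outside the unital case the Jordan identity forces \<open>p = 0\<close>. If moreover \<open>q = 0\<close>, it leaves only
  \<open>(b\<^sup>2 + d) (b + 1 + d) = 0\<close>, which is the diagonal case; if \<open>q \<noteq> 0\<close>, then \<open>e\<close> and \<open>f/q\<close> are
  orthogonal idempotents, whose sum is the unit of J2.\<close>

lemma idempotent_diagonal_classified:
  assumes T: "table e f 1 0 0 p 0 b d q" and not_unital: "b \<noteq> 1 \<or> d \<noteq> 1"
  shows classified
proof -
  note ef = table_frame[OF T]
  note coords = comb_add mult_comb[OF T] comb_eq_iff[OF ef]
  let ?e = "comb e f 1 0" and ?f = "comb e f 0 1"
  have 1: "p = 0 \<or> d = 1"
    using jordan[of ?f ?f, unfolded coords] by (simp add: algebra_simps)
  have 2: "p = 0 \<or> d * d = b * b" "q * (b + b * b + (b + d) * (b + d)) = 0"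
    using jordan_linearized[of ?f ?e ?e, unfolded coords] by (simp_all add: algebra_simps)
  have 3: "d * (1 + d) * p + (b + d) * q * q = 0"
    using jordan[of ?f ?e, unfolded coords] by (simp add: algebra_simps)
  have "b * b + (b * d + d * d) = d + (b * (b * b) + b * (b * d))"
    using jordan_linearized[of ?e ?e ?f, unfolded coords] by (simp add: algebra_simps)
  then have "(b * b + (b * d + d * d)) + (d + (b * (b * b) + b * (b * d))) = 0"
    by (simp only: add_self)
  moreover have "(b * b + d) * (b + 1 + d) =
      (b * b + (b * d + d * d)) + (d + (b * (b * b) + b * (b * d)))"
    by (simp add: algebra_simps)
  ultimately have 4: "(b * b + d) * (b + 1 + d) = 0" by simp
  have p: "p = 0"
    using 1 2(1) not_unital char2_power2_inj[OF char2, of b 1] by (auto simp: power2_eq_square)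
  show ?thesis
  proof (cases "q = 0")
    case True
    then show ?thesis
      using diagonal_classified[of e f 1 b d] T p 4
      by (auto simp: add_eq_0_iff_eq power2_eq_square add.commute)
  next
    case False
    then have "b = d" using 3 p by (simp add: add_eq_0_iff_eq)
    then have "b = 0 \<and> d = 0"
      using 2(2) False not_unital by (auto simp: add_eq_0_iff_eq)
    then have T: "table e f 1 0 0 0 0 0 0 q" using T p by simp
    have "table e (comb e f 1 (1/q)) 1 1 1 0 0 0 0 1"
      using frame_comb[OF ef, of 1 "1/q" 0 1] mult_comb[OF T, of 1 0 1 "1/q"]
        mult_comb[OF T, of 1 "1/q" 1 0] mult_comb[OF T, of 1 "1/q" 1 "1/q"] 
        mult_comb[OF T, of 1 0 1 0] False
      by (simp add: table_def)
    then show ?thesis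
      by (intro classifiedI[of J22]) (simp_all add: matrix_table_def vector_def)
  qed
qed

text \<open>Left and right multiplication by \<open>e\<close> commute, so a shift of \<open>f\<close> along \<open>e\<close> that diagonalizes one
  of them diagonalizes both, provided that one of the eigenvalues \<open>b\<close>, \<open>d\<close> differs from the
  eigenvalue 1 of \<open>e\<close>. If \<open>b = d = 1\<close>, right multiplication by \<open>e\<close> is still forced to be the identity,
  and either left multiplication is too, or the algebra is J1.\<close>

lemma idempotent_classified:
  assumes ef: "frame e f" and "mult e e = e"
  shows classified
proof -
  obtain a c p b d q where T: "table e f 1 a c p 0 b d q"
    using frame_obtain_table[OF ef] assms(2) unfolding table_def by (metis comb_unit(1))
  note coords = comb_add mult_comb[OF T] comb_eq_iff[OF ef]
  let ?e = "comb e f 1 0" and ?f = "comb e f 0 1"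
  have "a + b * c = c + a * d"
    using jordan[of ?e ?f, unfolded coords] by (simp add: algebra_simps)
  moreover have "a * (1 + d) + c * (1 + b) = (a + b * c) + (c + a * d)"
    by (simp add: algebra_simps)
  ultimately have commute: "a * (1 + d) = c * (1 + b)"
    by (simp add: add_eq_0_iff_eq)
  show ?thesis
  proof (cases "b = 1 \<and> d = 1")
    case False
    \<comment> \<open>The shift \<open>t\<close> must kill the \<open>e\<close>-components of \<open>e f\<close> and \<open>f e\<close> at once; the commutation
      relation makes the two conditions compatible.\<close>
    obtain t where t: "a = (1 + b) * t" "c = (1 + d) * t"
    proof (cases "b = 1")
      case True
      then have "1 + d \<noteq> 0" using False by (simp add: add_eq_0_iff_eq)
      then show thesis
        using that[of "c / (1 + d)"] True commute by simp
    next
      case False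
      then have "1 + b \<noteq> 0" by (simp add: add_eq_0_iff_eq)
      then show thesis
        using that[of "a / (1 + b)"] commute by (simp add: field_simps)
    qed
    let ?g = "comb e f t 1"
    obtain p' q' where sq: "mult ?g ?g = comb e ?g p' q'"
      using frame_coords[OF frame_shift[OF ef]] .
    have "mult e ?g = comb e ?g 0 b" "mult ?g e = comb e ?g 0 d"
      using mult_comb[OF T, of 1 0 t 1] mult_comb[OF T, of t 1 1 0]
        comb_comb[of e f 1 0 t 1 0]
      by (simp_all add: t algebra_simps)
    then have "table e ?g 1 0 0 p' 0 b d q'"
      using sq frame_shift[OF ef] assms(2) by (simp add: table_def)
    then show ?thesis
      using False idempotent_diagonal_classified by blast
  next
    case True
    note T = T[unfolded True[THEN conjunct1] True[THEN conjunct2]]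
    note coords = comb_add mult_comb[OF T] comb_eq_iff[OF ef]
    have c: "c = 0"
      using jordan_linearized[of ?e ?e ?f, unfolded coords] by (simp add: algebra_simps)
    have aq: "a * q = 0"
      using jordan_linearized[of ?f ?e ?e, unfolded coords] c by (simp add: algebra_simps)
    show ?thesis
    proof (cases "a = 0")
      case True
      then show ?thesis using T c unital_classified by simp
    next
      case False
      then have q: "q = 0" using aq by simp
      \<comment> \<open>Replacing \<open>f\<close> by \<open>f/a + t e\<close> changes its square to \<open>(p/a\<^sup>2 + t + t\<^sup>2) e\<close>.\<close>
      obtain t where "1 * t^2 + 1 * t + p / a^2 = 0" using quadratic_root[OF one_neq_zero] .
      then have t: "t * t + t + p / (a * a) = 0" by (simp add: power2_eq_square)
      let ?g = "comb e f t (1/a)"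
      have "mult ?g ?g = 0"
        unfolding mult_comb[OF T] using t c q False by (simp add: algebra_simps)
      moreover have "mult e ?g = comb ?g e 1 1" "mult ?g e = ?g"
        using mult_comb[OF T, of 1 0 t "1/a"] mult_comb[OF T, of t "1/a" 1 0] c False
          comb_comb[of e f t "1/a" 1 0 1 1]
        by (simp_all add: algebra_simps)
      moreover have "frame ?g e"
        using frame_comb[OF ef, of t 0 "1/a" 1] False by simp
      ultimately have "table ?g e 0 1 1 0 0 0 1 1"
        using assms(2) by (simp add: table_def)
      then show ?thesis
        by (intro classifiedI[of J12]) (simp_all add: matrix_table_def vector_def)
    qed
  qed
qed

text \<open>If \<open>b = d\<close>, every square vanishes, and the products span the line of \<open>n f\<close>, which is
  therefore invariant; if \<open>b \<noteq> d\<close>, the Jordan identity leaves only \<open>f n = d f\<close>. Both are diagonal.\<close>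

lemma symmetric_square_zero_classified:
  assumes T: "table n f 0 a a 0 0 b d 0" and nonzero: "a \<noteq> 0 \<or> b \<noteq> 0 \<or> d \<noteq> 0"
  shows classified
proof (cases "b = d")
  case True
  show ?thesis
  proof (cases "b = 0")
    case b: True
    then show ?thesis
      using diagonal_classified[OF table_swap, of n f a] T True nonzero by simp
  next
    case False
    let ?g = "comb n f a b"
    have sq: "mult (comb n f x y) (comb n f x y) = 0" for x y
      unfolding mult_comb[OF T] using True by (simp add: algebra_simps)
    have "frame n ?g" using frame_comb[OF table_frame[OF T], of 1 b 0 a] False by simp
    moreover have "mult n ?g = comb n ?g 0 b" "mult ?g n = comb n ?g 0 b"
      using mult_comb[OF T, of 1 0 a b] mult_comb[OF T, of a b 1 0] True
        comb_comb[of n f 1 0 a b 0 b]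
      by (simp_all add: algebra_simps)
    ultimately have "table n ?g 0 0 0 0 0 b b 0"
      using sq[of a b] sq[of 1 0] by (simp add: table_def)
    then show ?thesis
      using False diagonal_classified[of n ?g 0 b b] by simp
  qed
next
  case False
  then have ne: "b + d \<noteq> 0" by (simp add: add_eq_0_iff_eq)
  note coords = comb_add mult_comb[OF T] comb_eq_iff[OF table_frame[OF T]]
  let ?e = "comb n f 1 0" and ?f = "comb n f 0 1"
  have "(b + d) * (b * b) = 0"
    using jordan_linearized[of ?e ?e ?f, unfolded coords] by (simp add: algebra_simps)
  then have b: "b = 0" using ne by simp
  have "(b + d) * (a * d) = 0"
    using jordan_linearized[of ?f ?e ?e, unfolded coords] b by (simp add: algebra_simps)
  then have a: "a = 0" using ne b by simp
  then show ?thesis using diagonal_classified[of n f 0 b d] T b nonzero by simp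
qed

text \<open>With \<open>s = a + c\<close> and \<open>t = b + d\<close> the square of \<open>x n + y f\<close> is \<open>x y (s n + t f)\<close>, so \<open>s n + t f\<close>
  is a multiple of an idempotent unless \<open>s t = 0\<close>. Exchanging \<open>n\<close> and \<open>f\<close> exchanges \<open>s\<close> and \<open>t\<close>, hence
  one may take \<open>s = 0\<close>.\<close>

lemma two_square_zero_classified:
  assumes no_idempotent: "\<forall>u k. u \<noteq> 0 \<and> mult u u = scale k u \<longrightarrow> k = 0"
    and T: "table n f 0 a c 0 0 b d 0" and nonzero: "a \<noteq> 0 \<or> b \<noteq> 0 \<or> c \<noteq> 0 \<or> d \<noteq> 0"
  shows classified
proof -
  let ?u = "comb n f (a + c) (b + d)"
  have "mult ?u ?u = scale ((a + c) * (b + d)) ?u"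
    unfolding mult_comb[OF T] scale_comb by (simp add: algebra_simps)
  then have "?u = 0 \<or> (a + c) * (b + d) = 0"
    using no_idempotent by blast
  then have "a = c \<or> b = d"
    by (auto simp: comb_eq_0_iff[OF table_frame[OF T]] add_eq_0_iff_eq)
  then show ?thesis
    using symmetric_square_zero_classified[of n f a b d]
      symmetric_square_zero_classified[of f n b c a] T table_swap[OF T] nonzero
    by auto
qed

text \<open>In a basis \<open>n\<close>, \<open>f\<close> of this form only the multiples of \<open>n\<close> have a square parallel to
  themselves. The Jordan identity gives \<open>b = 0\<close> and \<open>a\<^sup>2 + a q + q\<^sup>2 = 0\<close>. For \<open>q = 0\<close> this is J8; otherwise
  scaling \<open>f\<close> by \<open>1/(a + q)\<close> turns the second equation into the condition on the parameter \<open>q/(a + q)\<close>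
  of J5.\<close>

lemma unique_square_zero_classified:
  assumes T: "table n f 0 a (a + q) 1 0 b b q"
  shows classified
proof -
  note coords = comb_add mult_comb[OF T] comb_eq_iff[OF table_frame[OF T]]
  let ?e = "comb n f 1 0" and ?f = "comb n f 0 1"
  have "b + (a * a + a * q + q * q) = 0" and 1: "b * (a + q) = 0"
    using jordan[of ?f ?f, unfolded coords] by (simp_all add: algebra_simps)
  then have 1: "b = a * a + a * q + q * q" "b * (a + q) = 0"
    by (simp_all add: add_eq_0_iff_eq)
  have 2: "b * q * q = 0"
    using jordan_linearized[of ?e ?f ?f, unfolded coords] by (simp add: algebra_simps)
  have b: "b = 0" using 1 2 by auto
  show ?thesis
  proof (cases "q = 0")
    case True
    then have "a = 0" using 1 b by simp
    then show ?thesis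
      using table_swap[OF T] True b
      by (intro classifiedI[of J82]) (simp_all add: matrix_table_def vector_def)
  next
    case False
    let ?k = "a + q"
    have k: "?k \<noteq> 0" using 1(1) b False by (auto simp: add_eq_0_iff_eq)
    have aq: "q * q + q * ?k + ?k * ?k = 0"
      using 1(1) b by (simp add: algebra_simps)
    have "(q * q + q * ?k + ?k * ?k) / (?k * ?k) = (q/?k)^2 + q/?k + 1"
      using k by (simp add: add_divide_distrib power2_eq_square)
    then have ok: "(q/?k)^2 + q/?k + 1 = 0" using aq by simp
    have "a / ?k + q / ?k = 1" using k by (simp flip: add_divide_distrib)
    then have "a / ?k = q / ?k + 1" by (metis add_self_left add.commute)
    then show ?thesis
      using table_scale[OF table_swap[OF T], of "1/?k" "1/(?k * ?k)"] k b ok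
      by (intro classifiedI[of "J52 (q/?k)"])
        (simp_all add: matrix_table_def vector_def power2_eq_square)
  qed
qed

text \<open>The square of \<open>f + y n\<close> is parallel to \<open>f + y n\<close> if \<open>(b + d) y\<^sup>2 + (a + c + q) y + p = 0\<close>. A root
  gives a second vector of square zero. A polynomial without root is a nonzero constant,
  so \<open>b = d\<close>, \<open>c = a + q\<close> and \<open>p \<noteq> 0\<close>, and scaling \<open>n\<close> makes \<open>p = 1\<close>.\<close>

lemma square_zero_classified:
  assumes no_idempotent: "\<forall>u k. u \<noteq> 0 \<and> mult u u = scale k u \<longrightarrow> k = 0"
    and nontrivial: "\<exists>u v. mult u v \<noteq> 0" and nf: "frame n f" and sq: "mult n n = 0"
  shows classified
proof -
  obtain a c p b d q where T: "table n f 0 a c p 0 b d q"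
    using frame_obtain_table[OF nf] sq unfolding table_def by (metis comb_unit(3))
  show ?thesis
  proof (cases "\<exists>y. (b + d) * y^2 + (a + c + q) * y + p = 0")
    case True
    then obtain y where y: "(b + d) * y^2 + (a + c + q) * y + p = 0" by blast
    let ?u = "comb n f y 1"
    have "(q + (b + d) * y) * y + (p + (a + c) * y) = (b + d) * y^2 + (a + c + q) * y + p"
      by (simp add: power2_eq_square algebra_simps)
    then have eq: "p + (a + c) * y = (q + (b + d) * y) * y"
      unfolding y add_eq_0_iff_eq by (rule sym)
    have "mult ?u ?u = comb n f (p + (a + c) * y) (q + (b + d) * y)"
      unfolding mult_comb[OF T] by (simp add: algebra_simps)
    then have "mult ?u ?u = scale (q + (b + d) * y) ?u"
      unfolding eq by (simp add: scale_comb)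
    moreover have "?u \<noteq> 0" using comb_eq_0_iff[OF nf] by simp
    ultimately have "mult ?u ?u = 0" using no_idempotent by fastforce
    moreover have nu: "frame n ?u" using frame_shift[OF nf] .
    ultimately obtain a' c' b' d' where T': "table n ?u 0 a' c' 0 0 b' d' 0"
      using frame_obtain_table[OF nu] sq unfolding table_def by (metis comb_unit(3))
    have "a' \<noteq> 0 \<or> b' \<noteq> 0 \<or> c' \<noteq> 0 \<or> d' \<noteq> 0"
    proof (rule ccontr)
      assume "\<not> ?thesis"
      then have "mult (comb n ?u x z) (comb n ?u x' z') = 0" for x z x' z'
        unfolding mult_comb[OF T'] by simp
      then show False using nontrivial frame_coords[OF nu] by metis
    qed
    then show ?thesis using two_square_zero_classified[OF no_idempotent T'] by blast
  next
    case False
    have "b + d = 0"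
      using False quadratic_root[of "b + d" "a + c + q" p] by metis
    moreover have "a + c + q = 0"
    proof (rule ccontr)
      assume "a + c + q \<noteq> 0"
      then have "(b + d) * (p / (a + c + q))^2 + (a + c + q) * (p / (a + c + q)) + p = 0"
        using \<open>b + d = 0\<close> by simp
      then show False using False by blast
    qed
    ultimately have "p \<noteq> 0" using False by auto
    have d: "d = b" and c: "c = a + q"
      using \<open>b + d = 0\<close> \<open>a + c + q = 0\<close>
      by (simp_all add: add_eq_0_iff_eq) (metis add.commute add.left_commute add_self_left)
    show ?thesis
      using table_scale[OF T, of p 1] \<open>p \<noteq> 0\<close> unfolding d c
      by (intro unique_square_zero_classified[of "comb n f p 0" "comb n f 0 1" a q "p * b"]) simp
  qed
qed

lemma exists_classification:
  assumes "frame e f" and nontrivial: "\<exists>u v. mult u v \<noteq> 0"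
  shows classified
proof (cases "\<exists>u k. u \<noteq> 0 \<and> k \<noteq> 0 \<and> mult u u = scale k u")
  case True
  then obtain u k where u: "u \<noteq> 0" "k \<noteq> 0" "mult u u = scale k u" by blast
  let ?e = "scale (1/k) u"
  have "?e \<noteq> 0" "mult ?e ?e = ?e"
    using u by (simp_all add: mult_scale_left mult_scale_right)
  then show ?thesis
    using extend_to_frame[OF assms(1), of ?e] idempotent_classified by blast
next
  case False
  then have no_idempotent: "\<forall>u k. u \<noteq> 0 \<and> mult u u = scale k u \<longrightarrow> k = 0"
    by blast
  obtain n where n: "n \<noteq> 0" "square_parallel n"
    using square_parallel_exists[OF assms(1)] .
  then have "mult n n = 0"
    using no_idempotent by (auto simp: square_parallel_def)
  moreover obtain v where "frame n v"
    using extend_to_frame[OF assms(1) n(1)] .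
  ultimately show ?thesis
    using square_zero_classified[OF no_idempotent nontrivial] by blast
qed

end

theorem theorem3p2:
  fixes scale :: "'f::alg_closed_field \<Rightarrow> 'v::ab_group_add \<Rightarrow> 'v"
    and mult :: "'v \<Rightarrow> 'v \<Rightarrow> 'v"
  assumes "CHAR('f) = 2"
    and "jordan_algebra scale mult"
    and "vector_space.dim scale (UNIV :: 'v set) = 2"
    and "\<exists>u v. mult u v \<noteq> 0"
  shows "\<exists>!L :: 'f jordan_label.
           jordan_param_ok L \<and>
           algebra_isomorphic scale mult (*s) (sc_mult (jordan_matrix L))"
proof -
  interpret char2_jordan_algebra scale mult
    using assms(1,2) by (simp add: char2_jordan_algebra_def char2_jordan_algebra_axioms_def)
  obtain e f where "frame e f" using frame_exists[OF assms(3)] .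
  then have classified using exists_classification assms(4) by blast
  then obtain L e f where L: "jordan_param_ok L" "matrix_table e f (jordan_matrix L)"
    unfolding classified_def by blast
  show ?thesis
  proof (rule ex1I[of _ L])
    show "jordan_param_ok L \<and> algebra_isomorphic scale mult (*s) (sc_mult (jordan_matrix L))"
      using L isomorphic_if_matrix_table by blast
    fix L'
    assume L': "jordan_param_ok L' \<and> algebra_isomorphic scale mult (*s) (sc_mult (jordan_matrix L'))"
    then obtain e' f' where "matrix_table e' f' (jordan_matrix L')"
      using matrix_table_if_isomorphic by blast
    then show "L' = L"
      using matrix_table_signature signature_unique L L' by blast
  qed
qed

end
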